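(* Let $\mathcal{A} \subset \mathcal{P}(n)$ be a union-closed family that contains at least $\binom{n-1}{2}+1$ of the $2$-element subsets of $\{1,\ldots,n\}$. Then $$|\{A\in \mathcal{A} : |A| = n - k \}| \geq |\{A\in \mathcal{A} : |A| = k \}|$$ for every integer $k$ with $0 \leq k \leq \left\lfloor \frac{n}{2} \right\rfloor$.
   Context: $\mathcal{P}(n)$ is the power set of $\{1,\ldots,n\}$. A family $\mathcal{A}$ of sets is union-closed if $A \cup B \in \mathcal{A}$ for all $A,B \in \mathcal{A}$. *)

theory Defs
  imports Complex_Main
begin

definition union_closed :: "'a set set \<Rightarrow> bool" where
  "union_closed \<A> \<longleftrightarrow> (\<forall>A\<in>\<A>. \<forall>B\<in>\<A>. A \<union> B \<in> \<A>)"

end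

theory Submission
  imports Defs
begin

text \<open>
  Put \<open>m = n - k\<close> with \<open>0 < k < m\<close>, and let \<open>H\<close> be the graph of the at most \<open>n - 2\<close> pairs
  missing from \<open>\<A>\<close>. If an \<open>m\<close>-set \<open>B\<close> is missing from \<open>\<A>\<close>, then the members of \<open>\<A>\<close> inside \<open>B\<close>
  do not cover some \<open>w \<in> B\<close>. Hence \<open>w\<close> is joined in \<open>H\<close> to all of \<open>B - {w}\<close>, and all
  \<open>(m - 1) choose (k - 1)\<close> of the \<open>k\<close>-subsets of \<open>B\<close> containing \<open>w\<close> are missing. Conversely,
  every \<open>k\<close>-set lies in at most \<open>(m - 1) choose (k - 1)\<close> of the \<open>m\<close>-sets that have a dominating
  vertex in \<open>H\<close>. If only one vertex dominates, this holds because it has a non-neighbour, which all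
  these \<open>m\<close>-sets avoid. Two different dominating vertices leave room only for \<open>m = k + 1\<close>, and then a
  \<open>k\<close>-set all of whose \<open>k + 1\<close> extensions are dominated would force \<open>2 * k = n - 1\<close> edges. Double
  counting shows that at least as many \<open>k\<close>-sets as \<open>m\<close>-sets are missing.
\<close>

section \<open>Stars and dominating vertices in a graph\<close>

definition star :: "'a \<Rightarrow> 'a set \<Rightarrow> 'a set set" where
  "star w B = (\<lambda>x. {w, x}) ` (B - {w})"

definition dominated :: "'a set set \<Rightarrow> 'a set \<Rightarrow> bool" where
  "dominated H B \<longleftrightarrow> (\<exists>w\<in>B. star w B \<subseteq> H)"

lemma star_iff: "e \<in> star w B \<longleftrightarrow> (\<exists>x\<in>B. x \<noteq> w \<and> e = {w, x})"
  by (auto simp: star_def)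

lemma finite_star: "finite B \<Longrightarrow> finite (star w B)"
  by (simp add: star_def)

lemma card_star: "card (star w B) = card (B - {w})"
  unfolding star_def by (rule card_image) (auto simp: inj_on_def doubleton_eq_iff)

text \<open>Stars with different centres share at most the edge \<open>{w, v}\<close>, and each has
  one edge fewer than its vertex set has points; together this gives the 3.\<close>

lemma card_star_Un:
  assumes "finite B" "finite C" "w \<in> B" "v \<in> C" "w \<noteq> v"
  shows "card B + card C \<le> card (star w B \<union> star v C) + 3"
proof -
  have "star w B \<inter> star v C \<subseteq> {{w, v}}"
    using \<open>w \<noteq> v\<close> by (auto simp: star_iff doubleton_eq_iff)
  then have "card (star w B \<inter> star v C) \<le> 1"
    using card_mono[of "{{w, v}}"] by fastforce
  moreover have "card (star w B) + card (star v C)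
      = card (star w B \<union> star v C) + card (star w B \<inter> star v C)"
    using assms by (intro card_Un_Int finite_star)
  moreover have "card (star w B) = card B - 1" "card (star v C) = card C - 1"
    using assms by (simp_all add: card_star)
  ultimately show ?thesis by linarith
qed

text \<open>If \<open>x\<close> is outside \<open>K\<close>, each \<open>B\<close> is determined by
  \<open>B - K\<close>, which consists of \<open>m - k\<close> of the \<open>m - 1\<close> points
  outside \<open>insert x K\<close>.\<close>

lemma card_supersets_avoiding:
  assumes "finite V" "K \<subseteq> V" "x \<in> V" "card V = m + k" "card K = k" "0 < k" "k \<le> m"
    and B: "\<And>B. B \<in> \<B> \<Longrightarrow> K \<subseteq> B \<and> B \<subseteq> V \<and> card B = m \<and> x \<notin> B"
  shows "card \<B> \<le> (m - 1) choose (k - 1)"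
proof (cases "x \<in> K")
  case True
  then have "\<B> = {}" using B by blast
  then show ?thesis by simp
next
  case False
  have finK: "finite K" using assms finite_subset by blast
  let ?T = "{T. T \<subseteq> V - insert x K \<and> card T = m - k}"
  have "card \<B> \<le> card ?T"
  proof (rule card_inj_on_le)
    show "inj_on (\<lambda>B. B - K) \<B>"
      using B by (intro inj_onI) blast
    show "(\<lambda>B. B - K) ` \<B> \<subseteq> ?T"
    proof
      fix T assume "T \<in> (\<lambda>B. B - K) ` \<B>"
      then obtain B' where B': "B' \<in> \<B>" "T = B' - K" by blast
      with B[OF B'(1)] show "T \<in> ?T"
        using finK \<open>card K = k\<close> by (auto simp: card_Diff_subset)
    qed
  qed (use \<open>finite V\<close> in auto)
  also have "\<dots> = card (V - insert x K) choose (m - k)"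
    using \<open>finite V\<close> by (simp add: n_subsets)
  also have "card (V - insert x K) = m - 1"
    using assms False finK by (subst card_Diff_subset) auto
  also have "(m - 1) choose (m - k) = (m - 1) choose (k - 1)"
    using binomial_symmetric[of "k - 1" "m - 1"] assms by simp
  finally show ?thesis .
qed

text \<open>If \<open>K\<close> itself has a dominating vertex, its star gives \<open>k - 1\<close>
  edges, and each of the \<open>k + 1\<close> outside points sends an edge into \<open>K\<close>.
  Otherwise each outside point is joined to all of \<open>K\<close>, and two of them already give
  \<open>2 * k\<close> edges.\<close>

lemma card_edges_if_all_extensions_dominated:
  assumes "finite V" "K \<subseteq> V" "card V = 2 * k + 1" "card K = k" "0 < k" "finite H"
    and dom: "\<And>x. x \<in> V - K \<Longrightarrow> dominated H (insert x K)"
  shows "2 * k \<le> card H"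
proof -
  have finK: "finite K" using assms finite_subset by blast
  have cVK: "card (V - K) = k + 1"
    using assms finK by (simp add: card_Diff_subset)
  have K0: "K \<noteq> {}" using assms by auto
  show ?thesis
  proof (cases "\<exists>w\<in>K. star w K \<subseteq> H")
    case True
    then obtain w where w: "w \<in> K" "star w K \<subseteq> H" by blast
    have "\<exists>z\<in>K. {x, z} \<in> H" if x: "x \<in> V - K" for x
    proof -
      obtain v where v: "v \<in> insert x K" "star v (insert x K) \<subseteq> H"
        using dom[OF x] by (auto simp: dominated_def)
      show ?thesis
      proof (cases "v = x")
        case True
        then show ?thesis using v x w(1) by (auto simp: star_def)
      next
        case False
        then have "{v, x} \<in> H" "v \<in> K" using v by (auto simp: star_def)
        then show ?thesis by (metis insert_commute)
      qed
    qed
    then obtain f where f: "\<And>x. x \<in> V - K \<Longrightarrow> f x \<in> K \<and> {x, f x} \<in> H" by metis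
    let ?F = "(\<lambda>x. {x, f x}) ` (V - K)"
    have "inj_on (\<lambda>x. {x, f x}) (V - K)"
      using f by (intro inj_onI) (auto simp: doubleton_eq_iff)
    then have "card ?F = k + 1" using cVK by (simp add: card_image)
    moreover have "card (star w K) = k - 1" using w assms by (simp add: card_star)
    moreover have "?F \<inter> star w K = {}"
      using w(1) by (auto simp: star_iff doubleton_eq_iff)
    then have "card (?F \<union> star w K) = card ?F + card (star w K)"
      using assms finK by (intro card_Un_disjoint finite_star) auto
    moreover have "card (?F \<union> star w K) \<le> card H"
      using f w assms by (intro card_mono) auto
    ultimately show ?thesis using \<open>0 < k\<close> by simp
  next
    case False
    \<comment> \<open>A dominating vertex of \<open>insert x K\<close> lying in \<open>K\<close>
      would dominate \<open>K\<close> too, so it must be \<open>x\<close>.\<close>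
    have *: "star x (insert x K) \<subseteq> H" if x: "x \<in> V - K" for x
      using dom[OF x] False by (auto simp: dominated_def star_def)
    obtain x y where xy: "x \<in> V - K" "y \<in> V - K" "x \<noteq> y"
      using cVK \<open>0 < k\<close> by (metis One_nat_def card_le_Suc0_iff_eq assms(1) finite_Diff
          Suc_eq_plus1 Suc_le_mono le_zero_eq neq0_conv)
    let ?s = "\<lambda>x. star x (insert x K)"
    have "card (?s x) = k" "card (?s y) = k"
      using xy assms by (simp_all add: card_star)
    moreover have "?s x \<inter> ?s y = {}"
      using xy by (auto simp: star_iff doubleton_eq_iff)
    then have "card (?s x \<union> ?s y) = card (?s x) + card (?s y)"
      using finK by (intro card_Un_disjoint finite_star) auto
    moreover have "card (?s x \<union> ?s y) \<le> card H"
      using *[OF xy(1)] *[OF xy(2)] assms by (intro card_mono) auto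
    ultimately show ?thesis by simp
  qed
qed

lemma card_dominated_supersets:
  assumes V: "finite V" "card V = m + k" and K: "K \<subseteq> V" "card K = k"
    and km: "0 < k" "k < m" and H: "finite H" "card H + 2 \<le> m + k"
  shows "card {B. K \<subseteq> B \<and> B \<subseteq> V \<and> card B = m \<and> dominated H B} \<le> (m - 1) choose (k - 1)"
    (is "card ?D \<le> _")
proof (cases "\<exists>x\<in>V. \<forall>B. B \<subseteq> V \<and> card B = m \<and> dominated H B \<longrightarrow> x \<notin> B")
  case True
  then obtain x where "x \<in> V" "\<And>B. B \<subseteq> V \<Longrightarrow> card B = m \<Longrightarrow> dominated H B \<Longrightarrow> x \<notin> B"
    by blast
  then show ?thesis
    using assms by (intro card_supersets_avoiding[of V K x]) auto
next
  case False
  have finK: "finite K" using V K finite_subset by blast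
  have "V \<noteq> {}" using V km by auto
  then obtain B w where B: "B \<subseteq> V" "card B = m" "w \<in> B" "star w B \<subseteq> H"
    using False by (fastforce simp: dominated_def)
  have "\<not> star w V \<subseteq> H"
  proof
    assume "star w V \<subseteq> H"
    then have "card (star w V) \<le> card H" using H card_mono by blast
    then show False using B V H by (auto simp: card_star)
  qed
  then obtain x where x: "x \<in> V" "x \<noteq> w" "{w, x} \<notin> H" by (auto simp: star_def)
  \<comment> \<open>By the case assumption no point is avoided by all dominated
    \<open>m\<close>-sets. Here \<open>v\<close> differs from \<open>w\<close> because
    \<open>w\<close> is not joined to \<open>x\<close>.\<close>
  then obtain C v where C: "C \<subseteq> V" "card C = m" "x \<in> C" "v \<in> C" "star v C \<subseteq> H"
    using False by (fastforce simp: dominated_def)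
  have "v \<noteq> w" using C x by (auto simp: star_def)
  moreover have "finite B" "finite C" using V B C finite_subset by blast+
  ultimately have "2 * m \<le> card (star w B \<union> star v C) + 3"
    using card_star_Un[of B C w v] B C by auto
  also have "\<dots> \<le> card H + 3"
    using B C H by (auto intro: card_mono)
  \<comment> \<open>The bound on \<open>card H\<close> gives \<open>2 * m \<le> m + k + 1\<close>,
    while \<open>k < m\<close>.\<close>
  finally have m: "m = k + 1" using H km by simp
  have cVK: "card (V - K) = k + 1" using V K m finK by (simp add: card_Diff_subset)
  let ?I = "(\<lambda>x. insert x K) ` (V - K)"
  have sub: "?D \<subseteq> ?I"
  proof
    fix A assume A: "A \<in> ?D"
    then have "card (A - K) = 1" using m K finK by (simp add: card_Diff_subset)
    then obtain y where "A - K = {y}" by (auto simp: card_1_singleton_iff)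
    then have "A = insert y K" "y \<in> V - K" using A by auto
    then show "A \<in> ?I" by blast
  qed
  have finI: "finite ?I" using V by auto
  have cI: "card ?I \<le> k + 1" using card_image_le[of "V - K" "\<lambda>x. insert x K"] V cVK by simp
  \<comment> \<open>This is one below the number of extensions of \<open>K\<close>. Were all of them
    dominated, \<open>H\<close> would have \<open>2 * k\<close> edges, but it has at most
    \<open>2 * k - 1\<close>.\<close>
  have "card ?D \<le> k"
  proof (rule ccontr)
    assume "\<not> card ?D \<le> k"
    then have "?D = ?I" using sub finI cI by (intro card_seteq) auto
    then have "dominated H (insert y K)" if "y \<in> V - K" for y using that by blast
    then have "2 * k \<le> card H"
      using V K m km H by (intro card_edges_if_all_extensions_dominated[of V K]) auto
    then show False using H m by simp
  qed
  also have "k = (m - 1) choose (k - 1)"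
    using m km binomial_symmetric[of 1 k] by simp
  finally show ?thesis .
qed

section \<open>Members of a union-closed family inside a given set\<close>

lemma union_closed_Union:
  assumes "union_closed \<A>" "finite \<S>" "\<S> \<noteq> {}" "\<S> \<subseteq> \<A>"
  shows "\<Union>\<S> \<in> \<A>"
  using assms(2-) by (induction rule: finite_ne_induct)
    (use \<open>union_closed \<A>\<close> in \<open>auto simp: union_closed_def\<close>)

text \<open>Otherwise \<open>B\<close> is the union of the members inside it, and
  \<open>B \<noteq> {}\<close> ensures that there is at least one such member.\<close>

lemma exists_uncovered_point:
  assumes "union_closed \<A>" "finite B" "B \<noteq> {}" "B \<notin> \<A>"
  obtains w where "w \<in> B" "\<And>S. S \<in> \<A> \<Longrightarrow> S \<subseteq> B \<Longrightarrow> w \<notin> S"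
proof -
  have "\<exists>w\<in>B. \<forall>S\<in>\<A>. S \<subseteq> B \<longrightarrow> w \<notin> S"
  proof (rule ccontr)
    assume "\<not> ?thesis"
    then have "B = \<Union>{S \<in> \<A>. S \<subseteq> B}" by blast
    moreover have "finite {S \<in> \<A>. S \<subseteq> B}"
      using \<open>finite B\<close> by (auto intro: finite_subset[of _ "Pow B"])
    ultimately have "B \<in> \<A>"
      using union_closed_Union[of \<A> "{S \<in> \<A>. S \<subseteq> B}"] assms by fastforce
    then show False using assms by simp
  qed
  then show thesis using that by blast
qed

text \<open>A pair \<open>{w, x}\<close> inside \<open>B\<close> contains \<open>w\<close>, so it
  cannot be a member.\<close>

lemma dominated_if_uncovered:
  assumes "w \<in> B" "B \<subseteq> V" and w: "\<And>S. S \<in> \<A> \<Longrightarrow> S \<subseteq> B \<Longrightarrow> w \<notin> S"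
  shows "dominated {e. e \<subseteq> V \<and> card e = 2 \<and> e \<notin> \<A>} B"
  unfolding dominated_def
proof (intro bexI[of _ w] subsetI)
  fix e assume "e \<in> star w B"
  then obtain x where "x \<in> B" "x \<noteq> w" "e = {w, x}" by (auto simp: star_iff)
  then show "e \<in> {e. e \<subseteq> V \<and> card e = 2 \<and> e \<notin> \<A>}"
    using assms(1,2) w[of e] by auto
qed fact

section \<open>Counting missing sets\<close>

lemma card_subsets_containing:
  assumes "finite B" "w \<in> B" "0 < k"
  shows "card {K. K \<subseteq> B \<and> card K = k \<and> w \<in> K} = (card B - 1) choose (k - 1)"
proof -
  have "{K. K \<subseteq> B \<and> card K = k \<and> w \<in> K} = insert w ` {T. T \<subseteq> B - {w} \<and> card T = k - 1}"
    (is "?L = insert w ` ?R")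
  proof (intro equalityI subsetI)
    fix K assume K: "K \<in> ?L"
    then have "K = insert w (K - {w})" "K - {w} \<in> ?R" by auto
    then show "K \<in> insert w ` ?R" by blast
  next
    fix K assume "K \<in> insert w ` ?R"
    then obtain T where T: "T \<subseteq> B - {w}" "card T = k - 1" "K = insert w T" by blast
    moreover have "finite T" using T assms finite_subset by blast
    moreover have "w \<notin> T" using T by blast
    ultimately show "K \<in> ?L" using assms by auto
  qed
  moreover have "inj_on (insert w) ?R" by (intro inj_onI) blast
  ultimately show ?thesis
    using assms by (simp add: card_image n_subsets)
qed

lemma card_missing_le:
  fixes V :: "'a set"
  assumes uc: "union_closed \<A>" and V: "finite V" "card V = m + k" and km: "0 < k" "k < m"
    and H: "card {e. e \<subseteq> V \<and> card e = 2 \<and> e \<notin> \<A>} + 2 \<le> m + k"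
  shows "card {B. B \<subseteq> V \<and> card B = m \<and> B \<notin> \<A>} \<le> card {K. K \<subseteq> V \<and> card K = k \<and> K \<notin> \<A>}"
    (is "card ?Mm \<le> card ?Mk")
proof -
  let ?H = "{e. e \<subseteq> V \<and> card e = 2 \<and> e \<notin> \<A>}"
  let ?c = "(m - 1) choose (k - 1)"
  have fin: "finite ?Mm" "finite ?Mk" "finite ?H"
    using V by (auto intro: finite_subset[of _ "Pow V"])
  have *: "dominated ?H B \<and> ?c \<le> card {K \<in> ?Mk. K \<subseteq> B}" if B: "B \<in> ?Mm" for B
  proof -
    have finB: "finite B" using B V finite_subset by blast
    have "B \<noteq> {}" using B km by auto
    then obtain w where w: "w \<in> B" "\<And>S. S \<in> \<A> \<Longrightarrow> S \<subseteq> B \<Longrightarrow> w \<notin> S"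
      using exists_uncovered_point[OF uc finB] B by blast
    have "?c = card {K. K \<subseteq> B \<and> card K = k \<and> w \<in> K}"
      using card_subsets_containing[OF finB w(1)] km B by simp
    also have "\<dots> \<le> card {K \<in> ?Mk. K \<subseteq> B}"
    proof (rule card_mono)
      show "finite {K \<in> ?Mk. K \<subseteq> B}" using fin(2) by (rule rev_finite_subset) blast
      show "{K. K \<subseteq> B \<and> card K = k \<and> w \<in> K} \<subseteq> {K \<in> ?Mk. K \<subseteq> B}" using w B by blast
    qed
    finally have "?c \<le> card {K \<in> ?Mk. K \<subseteq> B}" .
    moreover have "dominated ?H B"
      using w B by (intro dominated_if_uncovered[of w]) auto
    ultimately show ?thesis by (rule conjI[rotated])
  qed
  have **: "card {B \<in> ?Mm. K \<subseteq> B} \<le> ?c" if K: "K \<in> ?Mk" for K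
  proof -
    have "card {B \<in> ?Mm. K \<subseteq> B}
        \<le> card {B. K \<subseteq> B \<and> B \<subseteq> V \<and> card B = m \<and> dominated ?H B}"
    proof (rule card_mono)
      show "finite {B. K \<subseteq> B \<and> B \<subseteq> V \<and> card B = m \<and> dominated ?H B}"
        using V by (auto intro: finite_subset[of _ "Pow V"])
    qed (use * in blast)
    also have "\<dots> \<le> ?c"
      using K V km H fin by (intro card_dominated_supersets) auto
    finally show ?thesis .
  qed
  have "?c * card ?Mm \<le> (\<Sum>B\<in>?Mm. card {K \<in> ?Mk. K \<subseteq> B})"
    using sum_mono[of ?Mm "\<lambda>_. ?c" "\<lambda>B. card {K \<in> ?Mk. K \<subseteq> B}"] *
    by (simp add: mult.commute)
  also have "\<dots> = (\<Sum>K\<in>?Mk. card {B \<in> ?Mm. K \<subseteq> B})"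
    using fin by (intro sum_multicount_gen) auto
  also have "\<dots> \<le> ?c * card ?Mk"
    using sum_mono[of ?Mk "\<lambda>K. card {B \<in> ?Mm. K \<subseteq> B}" "\<lambda>_. ?c"] **
    by (simp add: mult.commute)
  \<comment> \<open>\<open>?c\<close> is positive because \<open>k - 1 \<le> m - 1\<close>, so it
    cancels.\<close>
  finally show ?thesis using km by simp
qed

text \<open>As layers \<open>k\<close> and \<open>n - k\<close> of the power set have equal size,
  this turns a comparison of missing sets into the reverse comparison of members.\<close>

lemma card_layer_add_missing:
  assumes "finite V" "\<A> \<subseteq> Pow V"
  shows "card {A \<in> \<A>. card A = j} + card {B. B \<subseteq> V \<and> card B = j \<and> B \<notin> \<A>} = card V choose j"
proof -
  have "card V choose j = card {B. B \<subseteq> V \<and> card B = j}" using assms by (simp add: n_subsets)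
  also have "{B. B \<subseteq> V \<and> card B = j}
      = {A \<in> \<A>. card A = j} \<union> {B. B \<subseteq> V \<and> card B = j \<and> B \<notin> \<A>}"
    using assms by blast
  also have "card \<dots> = card {A \<in> \<A>. card A = j} + card {B. B \<subseteq> V \<and> card B = j \<and> B \<notin> \<A>}"
    using assms by (intro card_Un_disjoint) (auto intro: finite_subset[of _ "Pow V"])
  finally show ?thesis by simp
qed

theorem theorem4:
  fixes n k :: nat and \<A> :: "nat set set"
  assumes "\<A> \<subseteq> Pow {1..n}"
    and "union_closed \<A>"
    and "card {A \<in> \<A>. card A = 2} \<ge> ((n - 1) choose 2) + 1"
    and "k \<le> n div 2"
  shows "card {A \<in> \<A>. card A = n - k} \<ge> card {A \<in> \<A>. card A = k}"
proof -
  define H where "H = {e. e \<subseteq> {1..n} \<and> card e = 2 \<and> e \<notin> \<A>}"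
  have part: "card {A \<in> \<A>. card A = j} + card {B. B \<subseteq> {1..n} \<and> card B = j \<and> B \<notin> \<A>} = n choose j"
    for j using card_layer_add_missing[of "{1..n}" \<A> j] assms(1) by simp
  have two: "card {A \<in> \<A>. card A = 2} + card H = n choose 2"
    using part[of 2] by (simp add: H_def)
  \<comment> \<open>For \<open>n = 0\<close> there are no pairs, yet the hypothesis asks for at
    least one.\<close>
  have "n \<noteq> 0" using two assms(3) by (intro notI) simp
  then have "n choose 2 = ((n - 1) choose 2) + (n - 1)"
    by (cases n) (simp_all add: numeral_2_eq_2)
  then have H: "card H + 2 \<le> n"
    using two assms(3) \<open>n \<noteq> 0\<close> by linarith
  \<comment> \<open>The double counting covers \<open>0 < k < n - k\<close>; the middle layer is
    trivial, and \<open>k = 0\<close> is argued separately.\<close>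
  consider "k = 0" | "n - k = k" | "0 < k" "k < n - k" using assms(4) by linarith
  then show ?thesis
  proof cases
    case 1
    \<comment> \<open>Otherwise some vertex would lie in \<open>n - 1\<close> missing pairs, more
      than \<open>H\<close> contains.\<close>
    have "{1..n} \<in> \<A>"
    proof (rule ccontr)
      assume "{1..n} \<notin> \<A>"
      then obtain w where w: "w \<in> {1..n}" "\<And>S. S \<in> \<A> \<Longrightarrow> S \<subseteq> {1..n} \<Longrightarrow> w \<notin> S"
        using exists_uncovered_point[OF assms(2), of "{1..n}"] \<open>n \<noteq> 0\<close> by auto
      then have "dominated H {1..n}"
        unfolding H_def by (intro dominated_if_uncovered) auto
      then obtain v where v: "v \<in> {1..n}" "star v {1..n} \<subseteq> H" by (auto simp: dominated_def)
      have "finite H" by (auto simp: H_def intro: finite_subset[of _ "Pow {1..n}"])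
      then have "card (star v {1..n}) \<le> card H" using v card_mono by blast
      then show False using v H by (simp add: card_star)
    qed
    then have "B \<in> \<A>" if "B \<subseteq> {1..n}" "card B = n" for B
      using card_subset_eq[OF _ that(1)] that(2) by simp
    then have "{B. B \<subseteq> {1..n} \<and> card B = n \<and> B \<notin> \<A>} = {}" by blast
    then have "card {B. B \<subseteq> {1..n} \<and> card B = n \<and> B \<notin> \<A>} = 0" by (simp only: card.empty)
    then have "card {A \<in> \<A>. card A = 0} \<le> card {A \<in> \<A>. card A = n}"
      using part[of 0] part[of n] binomial_n_0[of n] binomial_n_n[of n] by linarith
    then show ?thesis by (simp only: 1 diff_zero)
  next
    case 2
    then show ?thesis by simp
  next
    case 3
    have "card {B. B \<subseteq> {1..n} \<and> card B = n - k \<and> B \<notin> \<A>}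
        \<le> card {K. K \<subseteq> {1..n} \<and> card K = k \<and> K \<notin> \<A>}"
      using 3 H assms(2) by (intro card_missing_le) (auto simp: H_def)
    moreover have "n choose (n - k) = n choose k"
      using 3 binomial_symmetric[of k n] by simp
    ultimately show ?thesis using part[of k] part[of "n - k"] by linarith
  qed
qed

end
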